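(* Let $R$ be a noetherian integral domain (commutative), let $S\subseteq R$ be a prime-generated submonoid of the multiplicative monoid of $R$, and let $T$ be a commutative ring that is an $R$-algebra and is a localization of $R$ at $S$. If $T$ is a unique factorization domain, then $R$ is a unique factorization domain.
   Context: A submonoid $S\subseteq R$ is called prime-generated if every $s\in S$ can be written as a finite product $s=q_1\cdots q_n$ (with $n\ge 0$, the empty product being $1$) in which each $q_i$ satisfies $q_i\in S$ and $q_i$ is a prime element of $R$. That an $R$-algebra $T$ is a localization of $R$ at $S$ is meant in the abstract sense (Mathlib's IsLocalization): every element of $S$ maps to a unit of $T$; every element of $T$ has the form $\iota(a)\iota(s)^{-1}$ with $a\in R$, $s\in S$, where $\iota\colon R\to T$ is the structure map; and $\iota(a)=\iota(b)$ only if $ua=ub$ for some $u\in S$. *)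

theory Defs
  imports "HOL-Algebra.Algebra"
begin

text \<open>
  Noetherian domains, unique factorization domains and prime elements are the library notions
  \<^locale>\<open>noetherian_domain\<close>, \<^locale>\<open>factorial_domain\<close> and \<^const>\<open>ring_prime\<close>.
\<close>

locale prime_generated_submonoid = submonoid S R for S and R (structure) +
  assumes prime_factors_exist:
    "s \<in> S \<Longrightarrow> \<exists>qs. (\<forall>q \<in> set qs. q \<in> S \<and> ring_prime q) \<and> s = foldr (\<otimes>) qs \<one>"

text \<open>
  The structure map \<open>\<iota>\<close> is what makes the commutative ring \<open>T\<close> an \<open>R\<close>-algebra.
  The last axiom is stated as an implication only; the converse follows from the first one.
\<close>

locale localization = ring_hom_cring R T \<iota> + submonoid S R
  for R (structure) and S and T (structure) and \<iota> +
  assumes map_units: "s \<in> S \<Longrightarrow> \<iota> s \<in> Units T"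
    and surj: "t \<in> carrier T \<Longrightarrow> \<exists>a \<in> carrier R. \<exists>s \<in> S. t = \<iota> a \<otimes>\<^bsub>T\<^esub> inv\<^bsub>T\<^esub> (\<iota> s)"
    and exists_of_eq:
      "\<lbrakk> a \<in> carrier R; b \<in> carrier R; \<iota> a = \<iota> b \<rbrakk>
        \<Longrightarrow> \<exists>u \<in> S. u \<otimes>\<^bsub>R\<^esub> a = u \<otimes>\<^bsub>R\<^esub> b"

end

theory Submission
  imports Defs
begin

text \<open>
  This is Nagata's criterion. In a noetherian domain every nonzero nonunit is a product of
  irreducibles, so factoriality of \<open>R\<close> amounts to every irreducible \<open>p\<close> being prime
  (\<open>factorial_domainI\<close>).

  If a nonunit of \<open>S\<close> divides \<open>p\<close>, then so does a prime of \<open>S\<close>, and the irreducible \<open>p\<close> is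
  associated to that prime. Otherwise \<open>p\<close> is coprime to \<open>S\<close>, and primality can be checked in
  \<open>T\<close>: inverting \<open>S\<close> neither creates new divisibilities by \<open>p\<close> (\<open>divides_descent\<close>) nor
  makes \<open>p\<close> reducible (\<open>irreducible_in_localization\<close>). Irreducible elements of the factorial
  domain \<open>T\<close> are prime, so \<open>\<iota> p\<close> is prime, and descent of divisibility makes \<open>p\<close> prime.

  Both facts about inverting \<open>S\<close> come from one statement inside \<open>R\<close>: in an equation
  \<open>a \<otimes> b = c \<otimes> s\<close> with \<open>s \<in> S\<close>, the prime factors of \<open>s\<close> can be distributed over \<open>a\<close> and
  \<open>b\<close> and cancelled, which leaves a factorization of \<open>c\<close> (\<open>prime_generated_split\<close>).
\<close>

section \<open>Products of primes in a domain\<close>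

text \<open>
  Each prime factor of the list divides \<open>a\<close> or \<open>b\<close>; it is cancelled there and collected in
  \<open>s\<close> or \<open>t\<close>.
\<close>

lemma (in domain) prime_list_product_split:
  assumes "\<forall>q \<in> set qs. q \<in> S \<and> ring_prime q" and "submonoid S R"
    and "a \<in> carrier R" "b \<in> carrier R" "c \<in> carrier R"
    and "a \<otimes> b = c \<otimes> foldr (\<otimes>) qs \<one>"
  shows "\<exists>a' \<in> carrier R. \<exists>b' \<in> carrier R. \<exists>s \<in> S. \<exists>t \<in> S.
    c = a' \<otimes> b' \<and> a = a' \<otimes> s \<and> b = b' \<otimes> t"
  using assms
proof (induction qs arbitrary: a b)
  case Nil
  have "\<one> \<in> S" using submonoid.one_closed[OF Nil.prems(2)] .
  moreover have "c = a \<otimes> b" "a = a \<otimes> \<one>" "b = b \<otimes> \<one>" using Nil.prems by auto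
  ultimately show ?case using Nil.prems(3,4) by blast
next
  case (Cons q qs)
  interpret S: submonoid S R by fact
  note carr [simp] = Cons.prems(3-5)
  have q: "q \<in> S" "q \<noteq> \<zero>" "prime R q"
    using Cons.prems(1) unfolding ring_prime_def by auto
  have [simp]: "q \<in> carrier R" using q(1) by simp
  have "set qs \<subseteq> carrier R" using Cons.prems(1) S.subset by auto
  then have P [simp]: "foldr (\<otimes>) qs \<one> \<in> carrier R" by simp
  have IH: "\<exists>a' \<in> carrier R. \<exists>b' \<in> carrier R. \<exists>s \<in> S. \<exists>t \<in> S.
      c = a' \<otimes> b' \<and> x = a' \<otimes> s \<and> y = b' \<otimes> t"
    if "x \<in> carrier R" "y \<in> carrier R" "x \<otimes> y = c \<otimes> foldr (\<otimes>) qs \<one>" for x y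
    using Cons.IH[of x y] Cons.prems(1,2) that by simp
  have ab: "a \<otimes> b = q \<otimes> (c \<otimes> foldr (\<otimes>) qs \<one>)"
    using Cons.prems(6) by (simp add: m_lcomm)
  have "q divides a \<otimes> b" using ab by (intro dividesI[of "c \<otimes> foldr (\<otimes>) qs \<one>"]) auto
  then consider "q divides a" | "q divides b"
    using q(3) carr(1,2) unfolding prime_def by blast
  then show ?case
  proof cases
    case 1
    then obtain x where x [simp]: "x \<in> carrier R" and a: "a = q \<otimes> x" by (rule dividesE)
    have "q \<otimes> (x \<otimes> b) = q \<otimes> (c \<otimes> foldr (\<otimes>) qs \<one>)" using ab a by (simp add: m_assoc)
    then have "x \<otimes> b = c \<otimes> foldr (\<otimes>) qs \<one>" using q(2) by (simp add: m_lcancel)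
    then obtain a' b' s t where st: "a' \<in> carrier R" "b' \<in> carrier R" "s \<in> S" "t \<in> S"
      "c = a' \<otimes> b'" "x = a' \<otimes> s" "b = b' \<otimes> t" using IH[of x b] by auto
    then have "a = a' \<otimes> (q \<otimes> s)" "q \<otimes> s \<in> S" using a q(1) by (auto simp: m_lcomm)
    then show ?thesis using st by blast
  next
    case 2
    then obtain y where y [simp]: "y \<in> carrier R" and b: "b = q \<otimes> y" by (rule dividesE)
    have "q \<otimes> (a \<otimes> y) = q \<otimes> (c \<otimes> foldr (\<otimes>) qs \<one>)" using ab b by (simp add: m_lcomm)
    then have "a \<otimes> y = c \<otimes> foldr (\<otimes>) qs \<one>" using q(2) by (simp add: m_lcancel)
    then obtain a' b' s t where st: "a' \<in> carrier R" "b' \<in> carrier R" "s \<in> S" "t \<in> S"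
      "c = a' \<otimes> b'" "a = a' \<otimes> s" "y = b' \<otimes> t" using IH[of a y] by auto
    then have "b = b' \<otimes> (q \<otimes> t)" "q \<otimes> t \<in> S" using b q(1) by (auto simp: m_lcomm)
    then show ?thesis using st by blast
  qed
qed

lemma (in domain) prime_generated_split:
  assumes "prime_generated_submonoid S R" and "s \<in> S"
    and "a \<in> carrier R" "b \<in> carrier R" "c \<in> carrier R" and "a \<otimes> b = c \<otimes> s"
  obtains a' b' u v where "a' \<in> carrier R" "b' \<in> carrier R" "u \<in> S" "v \<in> S"
    and "c = a' \<otimes> b'" "a = a' \<otimes> u" "b = b' \<otimes> v"
proof -
  interpret prime_generated_submonoid S R by fact
  obtain qs where "\<forall>q \<in> set qs. q \<in> S \<and> ring_prime q" "s = foldr (\<otimes>) qs \<one>"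
    using prime_factors_exist[OF assms(2)] by blast
  then show thesis
    using prime_list_product_split[OF _ submonoid_axioms assms(3-5)] assms(6) that by blast
qed

text \<open>
  Splitting \<open>p \<otimes> c = a \<otimes> s\<close> factors the target \<open>a\<close> as \<open>p' \<otimes> c'\<close> where \<open>p'\<close> differs from
  \<open>p\<close> only by a divisor of \<open>p\<close> in \<open>S\<close>. Such a divisor is a unit by the coprimality
  assumption, so \<open>p'\<close> is associated to \<open>p\<close>.
\<close>

lemma (in domain) divides_cancel_submonoid:
  assumes S: "prime_generated_submonoid S R" and "s \<in> S"
    and p: "p \<in> carrier R" and a: "a \<in> carrier R"
    and coprime: "\<forall>u \<in> S. u divides p \<longrightarrow> u \<in> Units R"
    and dvd: "p divides a \<otimes> s"
  shows "p divides a"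
proof -
  interpret S: prime_generated_submonoid S R by fact
  obtain c where c: "c \<in> carrier R" "a \<otimes> s = p \<otimes> c" using dvd by (rule dividesE)
  obtain p' c' u v where *: "p' \<in> carrier R" "c' \<in> carrier R" "u \<in> S" "v \<in> S"
    "a = p' \<otimes> c'" "p = p' \<otimes> u"
    using prime_generated_split[OF S \<open>s \<in> S\<close> p c(1) a c(2)[symmetric]] .
  have uc: "u \<in> carrier R" using S.mem_carrier[OF *(3)] .
  have "p = u \<otimes> p'" unfolding *(6) using *(1) uc by (rule m_comm)
  then have "u divides p" by (rule dividesI[OF *(1)])
  then have u: "u \<in> Units R" using coprime *(3) by blast
  have "p \<otimes> (inv u \<otimes> c') = p' \<otimes> ((u \<otimes> inv u) \<otimes> c')"
    unfolding *(6) using *(1,2) uc Units_inv_closed[OF u] by (simp only: m_assoc m_closed)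
  also have "\<dots> = a" unfolding *(5) using *(2) u by simp
  finally have "a = p \<otimes> (inv u \<otimes> c')" ..
  then show ?thesis by (rule dividesI[rotated]) (use u *(2) in simp)
qed

lemma (in domain) irreducible_prime_if_divisor_in_submonoid:
  assumes S: "prime_generated_submonoid S R"
    and p: "p \<in> carrier R" "ring_irreducible p"
    and u: "u \<in> S" "u divides p" "u \<notin> Units R"
  shows "prime R p"
proof -
  interpret S: prime_generated_submonoid S R by fact
  obtain qs where qs: "\<forall>q \<in> set qs. q \<in> S \<and> ring_prime q" "u = foldr (\<otimes>) qs \<one>"
    using S.prime_factors_exist[OF u(1)] by blast
  have "qs \<noteq> []" using qs u(3) by auto
  then obtain q qs' where cons: "qs = q # qs'" by (cases qs) auto
  have q: "q \<in> S" "prime R q" and q0: "q \<noteq> \<zero>"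
    using qs cons unfolding ring_prime_def by auto
  have "set qs' \<subseteq> carrier R" using qs(1) cons S.subset by auto
  then have P: "foldr (\<otimes>) qs' \<one> \<in> carrier R" by simp
  obtain d where d: "d \<in> carrier R" "p = u \<otimes> d" using u(2) by (rule dividesE)
  \<comment> \<open>the cofactor of \<open>q\<close> in \<open>p\<close>, which irreducibility forces to be a unit\<close>
  define e where "e = foldr (\<otimes>) qs' \<one> \<otimes> d"
  have e: "e \<in> carrier R" "p = q \<otimes> e" using d P q(1) qs(2) cons by (auto simp: m_assoc e_def)
  have "q \<notin> Units R" using q(2) by (simp add: prime_def)
  then have eU: "e \<in> Units R" using ring_irreducibleE(5)[OF p _ e(1,2)] q(1) by auto
  have qc: "q \<in> carrier R" using q(1) by simp
  have "p = e \<otimes> q" using e qc by (simp add: m_comm)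
  then have "p \<sim> q" using ring_associated_iff[OF p(1) qc] eU by blast
  then have "q \<sim>\<^bsub>mult_of R\<^esub> p"
    using assoc_iff_assoc_mult[OF qc p(1)] associated_sym by blast
  moreover have "prime (mult_of R) q" using q(2) prime_eq_prime_mult[OF qc] by blast
  moreover have "q \<in> carrier (mult_of R)" "p \<in> carrier (mult_of R)"
    using qc p ring_irreducibleE(1)[OF p] q0 by auto
  ultimately have "prime (mult_of R) p" using mult_of.prime_cong by blast
  then show ?thesis using prime_eq_prime_mult[OF p(1)] by blast
qed

section \<open>Descent along the localization\<close>

locale domain_localization = R?: domain R + T: domain T + localization R S T \<iota>
  for R (structure) and S and T (structure) and \<iota>
begin

lemma submonoid_nonzero:
  assumes "s \<in> S" shows "s \<noteq> \<zero>"
proof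
  assume "s = \<zero>"
  then have "\<zero>\<^bsub>T\<^esub> \<in> Units T" using map_units[OF assms] by simp
  then show False by (metis T.Units_r_inv T.Units_inv_closed T.l_null T.one_not_zero)
qed

lemma structure_map_inj:
  assumes "a \<in> carrier R" "b \<in> carrier R" "\<iota> a = \<iota> b"
  shows "a = b"
proof -
  obtain u where "u \<in> S" "u \<otimes> a = u \<otimes> b" using exists_of_eq[OF assms] by blast
  then show ?thesis using submonoid_nonzero assms(1,2) R.m_lcancel by simp
qed

text \<open>The form in which surjectivity is used: it avoids inverses in \<open>T\<close>.\<close>

lemma clear_denominator:
  assumes "x \<in> carrier T"
  obtains a s where "a \<in> carrier R" "s \<in> S" "\<iota> a = x \<otimes>\<^bsub>T\<^esub> \<iota> s"
proof -
  obtain a s where *: "a \<in> carrier R" "s \<in> S" "x = \<iota> a \<otimes>\<^bsub>T\<^esub> inv\<^bsub>T\<^esub> \<iota> s"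
    using surj[OF assms] by blast
  then have "\<iota> a = x \<otimes>\<^bsub>T\<^esub> \<iota> s"
    using map_units[OF *(2)] by (simp add: T.m_assoc)
  then show thesis using * that by blast
qed

lemma divides_descent:
  assumes S: "prime_generated_submonoid S R"
    and p: "p \<in> carrier R" and a: "a \<in> carrier R"
    and coprime: "\<forall>u \<in> S. u divides p \<longrightarrow> u \<in> Units R"
    and dvd: "\<iota> p divides\<^bsub>T\<^esub> \<iota> a"
  shows "p divides a"
proof -
  obtain x where x: "x \<in> carrier T" "\<iota> a = \<iota> p \<otimes>\<^bsub>T\<^esub> x" using dvd by (rule dividesE)
  obtain c s where c: "c \<in> carrier R" "s \<in> S" "\<iota> c = x \<otimes>\<^bsub>T\<^esub> \<iota> s"
    using clear_denominator[OF x(1)] .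
  have "\<iota> (a \<otimes> s) = \<iota> (p \<otimes> c)" using p a c x by (simp add: T.m_assoc)
  then have "a \<otimes> s = p \<otimes> c" using structure_map_inj p a c by simp
  then have "p divides a \<otimes> s" using c(1) by (intro dividesI[of c])
  then show ?thesis using R.divides_cancel_submonoid[OF S c(2) p a coprime] by simp
qed

text \<open>
  Clearing denominators in a factorization of \<open>\<iota> p\<close> and splitting brings it back to a
  factorization \<open>p = a' \<otimes> b'\<close> in \<open>R\<close>. The factors in \<open>T\<close> differ from the images of
  \<open>a'\<close> and \<open>b'\<close> only by images of elements of \<open>S\<close>, which are units of \<open>T\<close>.
  Coprimality to \<open>S\<close> is needed only to prevent \<open>\<iota> p\<close> from becoming a unit.
\<close>

lemma irreducible_in_localization:
  assumes S: "prime_generated_submonoid S R"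
    and p: "p \<in> carrier R" "ring_irreducible p"
    and coprime: "\<forall>u \<in> S. u divides p \<longrightarrow> u \<in> Units R"
  shows "ring_irreducible\<^bsub>T\<^esub> (\<iota> p)"
proof (rule T.ring_irreducibleI)
  have "\<iota> p \<noteq> \<iota> \<zero>"
    using structure_map_inj[OF p(1) R.zero_closed] R.ring_irreducibleE(1)[OF p] by blast
  then show "\<iota> p \<in> carrier T - {\<zero>\<^bsub>T\<^esub>}"
    using hom_closed[OF p(1)] by simp
  show "\<iota> p \<notin> Units T"
  proof
    assume "\<iota> p \<in> Units T"
    then have "\<iota> p divides\<^bsub>T\<^esub> \<iota> \<one>"
      unfolding hom_one using T.divides_one[OF hom_closed[OF p(1)]] by blast
    then have "p divides \<one>" using divides_descent[OF S p(1) R.one_closed coprime] by blast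
    then show False using R.divides_one[OF p(1)] R.ring_irreducibleE(4)[OF p] by blast
  qed
next
  fix x y assume x: "x \<in> carrier T" and y: "y \<in> carrier T" and xy: "\<iota> p = x \<otimes>\<^bsub>T\<^esub> y"
  obtain a s where a: "a \<in> carrier R" "s \<in> S" "\<iota> a = x \<otimes>\<^bsub>T\<^esub> \<iota> s" using clear_denominator[OF x] .
  obtain b t where b: "b \<in> carrier R" "t \<in> S" "\<iota> b = y \<otimes>\<^bsub>T\<^esub> \<iota> t" using clear_denominator[OF y] .
  have "\<iota> (a \<otimes> b) = \<iota> (p \<otimes> (s \<otimes> t))"
    using a b p(1) x y by (simp add: xy T.m_ac)
  then have ab: "a \<otimes> b = p \<otimes> (s \<otimes> t)"
    by (rule structure_map_inj[rotated 2]) (use a b p(1) in simp_all)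
  obtain a' b' u v where *: "a' \<in> carrier R" "b' \<in> carrier R" "u \<in> S" "v \<in> S"
      "p = a' \<otimes> b'" "a = a' \<otimes> u" "b = b' \<otimes> v"
    using R.prime_generated_split[OF S m_closed[OF a(2) b(2)] a(1) b(1) p(1) ab] by blast
  \<comment> \<open>a unit factor in \<open>R\<close> yields a unit factor in \<open>T\<close>, applied to either side\<close>
  have unit: "z \<in> Units T"
    if "z \<in> carrier T" "d \<in> Units R" "w \<in> S" "r \<in> S" "\<iota> (d \<otimes> w) = z \<otimes>\<^bsub>T\<^esub> \<iota> r" for z d w r
  proof -
    have d: "d \<in> carrier R" "inv d \<in> carrier R" "d \<otimes> inv d = \<one>" using that(2) by auto
    then have "\<iota> d \<otimes>\<^bsub>T\<^esub> \<iota> (inv d) = \<one>\<^bsub>T\<^esub>" using hom_mult[of d "inv d"] by simp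
    then have "\<iota> d divides\<^bsub>T\<^esub> \<one>\<^bsub>T\<^esub>"
      using hom_closed[OF d(2)] by (intro dividesI[of "\<iota> (inv d)"]) simp_all
    then have "\<iota> d \<in> Units T" using T.divides_one hom_closed[OF d(1)] by blast
    then have "\<iota> d \<otimes>\<^bsub>T\<^esub> \<iota> w \<in> Units T" using map_units[OF that(3)] by (rule T.Units_m_closed)
    then have "z \<otimes>\<^bsub>T\<^esub> \<iota> r \<in> Units T" using that(3,5) d(1) by simp
    then show ?thesis
      using T.unit_factor[OF _ that(1) hom_closed[OF mem_carrier[OF that(4)]]] by blast
  qed
  have "a' \<in> Units R \<or> b' \<in> Units R" using R.ring_irreducibleE(5)[OF p *(1,2,5)] .
  then show "x \<in> Units T \<or> y \<in> Units T"
  proof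
    assume "a' \<in> Units R"
    then have "x \<in> Units T" by (rule unit[OF x _ *(3) a(2)]) (use a(3) *(6) in simp)
    then show ?thesis ..
  next
    assume "b' \<in> Units R"
    then have "y \<in> Units T" by (rule unit[OF y _ *(4) b(2)]) (use b(3) *(7) in simp)
    then show ?thesis ..
  qed
qed

text \<open>
  The case distinction is on whether \<open>p\<close> is coprime to \<open>S\<close>: only then does \<open>\<iota> p\<close> remain a
  nonunit, so that the factoriality of \<open>T\<close> says something about \<open>p\<close>.
\<close>

lemma irreducible_imp_prime:
  assumes S: "prime_generated_submonoid S R" and T: "factorial_domain T"
    and p: "p \<in> carrier R" "ring_irreducible p"
  shows "prime R p"
proof (cases "\<forall>u \<in> S. u divides p \<longrightarrow> u \<in> Units R")
  case False
  then show ?thesis using R.irreducible_prime_if_divisor_in_submonoid[OF S p] by blast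
next
  case True
  interpret T: factorial_domain T by fact
  have irr: "ring_irreducible\<^bsub>T\<^esub> (\<iota> p)" using irreducible_in_localization[OF S p True] .
  then have "prime (mult_of T) (\<iota> p)"
    using T.irreducible_prime T.ring_irreducibleE(1,3)[OF hom_closed[OF p(1)] irr] p(1) by simp
  then have prime: "prime T (\<iota> p)" using T.prime_eq_prime_mult[OF hom_closed[OF p(1)]] by blast
  show ?thesis
  proof (rule primeI)
    show "p \<notin> Units R" using R.ring_irreducibleE(4)[OF p] .
  next
    fix a b assume a: "a \<in> carrier R" and b: "b \<in> carrier R" and "p divides a \<otimes> b"
    then have "\<iota> p divides\<^bsub>T\<^esub> \<iota> a \<otimes>\<^bsub>T\<^esub> \<iota> b"
      using p(1) a b by (metis dividesE dividesI hom_closed hom_mult)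
    then have "\<iota> p divides\<^bsub>T\<^esub> \<iota> a \<or> \<iota> p divides\<^bsub>T\<^esub> \<iota> b"
      using prime hom_closed[OF a] hom_closed[OF b] unfolding prime_def by blast
    then show "p divides a \<or> p divides b"
      using divides_descent[OF S p(1) _ True] a b by blast
  qed
qed

end

section \<open>Factoriality\<close>

lemma (in noetherian_domain) factorial_domainI:
  assumes "\<And>p. p \<in> carrier R \<Longrightarrow> ring_irreducible p \<Longrightarrow> prime R p"
  shows "factorial_domain R"
proof -
  interpret M: primeness_condition_monoid "mult_of R"
  proof
    fix p assume "p \<in> carrier (mult_of R)" "irreducible (mult_of R) p"
    then show "prime (mult_of R) p"
      using assms[of p] ring_irreducibleI' prime_eq_prime_mult by simp
  qed
  have "factorial_monoid (mult_of R)"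
  proof (rule mult_of.factorial_monoidI)
    fix a assume "a \<in> carrier (mult_of R)" "a \<notin> Units (mult_of R)"
    then show "\<exists>fs. set fs \<subseteq> carrier (mult_of R) \<and> wfactors (mult_of R) fs a"
      using factorization_property by simp
  qed (rule M.wfactors_unique)
  then show ?thesis using domain_axioms by (simp add: factorial_domain_def)
qed

theorem mainTheorem2:
  fixes R :: "('a, 'm) ring_scheme" and T :: "('b, 'n) ring_scheme"
    and S :: "'a set" and \<iota> :: "'a \<Rightarrow> 'b"
  assumes "noetherian_domain R"
    and "prime_generated_submonoid S R"
    and "localization R S T \<iota>"
    and "factorial_domain T"
  shows "factorial_domain R"
proof -
  interpret R: noetherian_domain R by fact
  interpret T: factorial_domain T by fact
  interpret domain_localization R S T \<iota>
    using assms(3) R.domain_axioms T.domain_axioms by (intro domain_localization.intro)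
  show ?thesis using R.factorial_domainI irreducible_imp_prime[OF assms(2,4)] by blast
qed

end
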